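(* For every pair of ordered bases $\mathbf{p}$ of $\mathcal{V}_{n,d}$ and $\mathbf{q}$ of $\mathcal{V}_{n,2d}$, and the corresponding operator $\Lambda:\mathbb{R}^U\to\mathbb{S}^L$, one has, for every $\mathbf{x}$ in the interior of $\Sigma_{n,2d}^*$, $$\operatorname{cond}(H(\mathbf{x}))\leq\operatorname{cond}(\mathbf{\Lambda})^2\operatorname{cond}(\Lambda(\mathbf{x}))^2,$$ where $H(\mathbf{x})$ is the Hessian at $\mathbf{x}$ of the function $F(\mathbf{x})=-\ln(\det(\Lambda(\mathbf{x})))$ and $\mathbf{\Lambda}$ is the $L^2\times U$ matrix representing $\Lambda$.
   Context: $\mathcal{V}_{n,r}$ is the space of real $n$-variate polynomials of total degree at most $r$; $L=\dim\mathcal{V}_{n,d}=\binom{n+d}{n}$, $U=\dim\mathcal{V}_{n,2d}=\binom{n+2d}{n}$; $\mathbb{S}^L$ is the space of real symmetric $L\times L$ matrices. For ordered bases $\mathbf{p}=(p_1,\ldots,p_L)$ of $\mathcal{V}_{n,d}$ and $\mathbf{q}=(q_1,\ldots,q_U)$ of $\mathcal{V}_{n,2d}$, $\Lambda:\mathbb{R}^U\to\mathbb{S}^L$ is the unique linear map with $\Lambda(\mathbf{q})=\mathbf{p}\mathbf{p}^{\mathrm T}$, i.e. $\Lambda(\mathbf{x})=\sum_u x_u\mathbf{E}_u$ where $\mathbf{E}_u\in\mathbb{S}^L$ and $p_ip_j=\sum_u(\mathbf{E}_u)_{ij}q_u$ as polynomials for all $i,j$. The matrix $\mathbf{\Lambda}\in\mathbb{R}^{L^2\times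 U}$ has $u$-th column $\operatorname{vec}(\mathbf{E}_u)$ (the stacked columns of $\mathbf{E}_u$), $u=1,\ldots,U$. $\Sigma_{n,2d}\subset\mathbb{R}^U$ is the cone of coefficient vectors (in the basis $\mathbf{q}$) of polynomials in $\mathcal{V}_{n,2d}$ that are finite sums of squares of polynomials in $\mathcal{V}_{n,d}$, and $\Sigma_{n,2d}^*=\{\mathbf{x}\in\mathbb{R}^U:\mathbf{s}^{\mathrm T}\mathbf{x}\ge0\ \forall\,\mathbf{s}\in\Sigma_{n,2d}\}$ is its dual cone; it is known that $\Sigma_{n,2d}^*=\{\mathbf{x}:\Lambda(\mathbf{x})\succeq0\}$. For a real matrix $\mathbf{Q}$, $\operatorname{cond}(\mathbf{Q})$ is the condition number with respect to the $\ell_2$-norm: the ratio of the largest to the smallest singular value of $\mathbf{Q}$. *)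

theory Defs
  imports "HOL-Analysis.Analysis" "HOL-Analysis.Finite_Function_Topology"
begin


section \<open>Polynomials\<close>

text \<open>A polynomial is a finitely supported map from monomials to coefficients, a monomial a finitely
  supported map from variable indices to exponents; the product is the convolution product
  of \<^theory>\<open>HOL-Library.Poly_Mapping\<close>. An \<open>n\<close>-variate polynomial involves the
  variables \<open>0, \<dots>, n - 1\<close> only.\<close>

type_synonym rpoly = "(nat \<Rightarrow>\<^sub>0 nat) \<Rightarrow>\<^sub>0 real"

definition mon_deg :: "(nat \<Rightarrow>\<^sub>0 nat) \<Rightarrow> nat" where
  "mon_deg m = (\<Sum>i\<in>Poly_Mapping.keys m. Poly_Mapping.lookup m i)"

definition polys :: "nat \<Rightarrow> nat \<Rightarrow> rpoly set" where
  "polys n r = {f. \<forall>m\<in>Poly_Mapping.keys f. Poly_Mapping.keys m \<subseteq> {..<n} \<and> mon_deg m \<le> r}"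

text \<open>A basis indexed by a finite type \<open>'i\<close>; for \<open>W = polys n r\<close> this forces
  \<open>CARD('i) = (n + r) choose n\<close>.\<close>

definition basis_of :: "('i::finite \<Rightarrow> 'v::real_vector) \<Rightarrow> 'v set \<Rightarrow> bool" where
  "basis_of b W \<longleftrightarrow> inj b \<and> independent (range b) \<and> span (range b) = W"

section \<open>The operator $\Lambda$\<close>

text \<open>The entry \<open>(i, j)\<close> of \<open>coeff_mat p q u\<close> is the coefficient of \<open>q u\<close> in the expansion
  of \<open>p i * p j\<close> in the basis \<open>q\<close>; see \<open>coeff_mat_expansion\<close> below.\<close>

definition coeff_mat :: "('l::finite \<Rightarrow> rpoly) \<Rightarrow> ('u::finite \<Rightarrow> rpoly) \<Rightarrow> 'u \<Rightarrow> real^'l^'l" where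
  "coeff_mat p q u = (\<chi> i j. representation (range q) (p i * p j) (q u))"

definition Lam :: "('l::finite \<Rightarrow> rpoly) \<Rightarrow> ('u::finite \<Rightarrow> rpoly) \<Rightarrow> real^'u \<Rightarrow> real^'l^'l" where
  "Lam p q x = (\<Sum>u\<in>UNIV. x $ u *\<^sub>R coeff_mat p q u)"

text \<open>Columns stacked: the row index of a vectorized matrix is the pair (column, row).\<close>

definition vec_mat :: "real^'c^'r \<Rightarrow> real^('c \<times> 'r)" where
  "vec_mat A = (\<chi> k. A $ snd k $ fst k)"

definition Lam_matrix ::
    "('l::finite \<Rightarrow> rpoly) \<Rightarrow> ('u::finite \<Rightarrow> rpoly) \<Rightarrow> real^'u^('l \<times> 'l)" where
  "Lam_matrix p q = (\<chi> k u. vec_mat (coeff_mat p q u) $ k)"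

section \<open>The sums-of-squares cone and its dual\<close>

definition sos_cone :: "nat \<Rightarrow> nat \<Rightarrow> ('u::finite \<Rightarrow> rpoly) \<Rightarrow> (real^'u) set" where
  "sos_cone n d q = {s. \<exists>fs. set fs \<subseteq> polys n d \<and>
     (\<Sum>u\<in>UNIV. s $ u *\<^sub>R q u) = (\<Sum>f\<leftarrow>fs. f\<^sup>2)}"

definition dual_cone :: "'a::real_inner set \<Rightarrow> 'a set" where
  "dual_cone S = {x. \<forall>s\<in>S. s \<bullet> x \<ge> 0}"

section \<open>Hessian\<close>

definition partial_deriv :: "(real^'n \<Rightarrow> real) \<Rightarrow> 'n::finite \<Rightarrow> real^'n \<Rightarrow> real" where
  "partial_deriv f i x = deriv (\<lambda>t. f (x + t *\<^sub>R axis i 1)) 0"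

definition hessian :: "(real^'n::finite \<Rightarrow> real) \<Rightarrow> real^'n \<Rightarrow> real^'n^'n" where
  "hessian f x = (\<chi> i j. partial_deriv (partial_deriv f j) i x)"

section \<open>Condition number\<close>

text \<open>For an \<open>m\<close> by \<open>n\<close> matrix these are exactly the values of the \<open>min m n\<close> diagonal entries in a
  singular value decomposition: a pair for \<open>\<sigma> = 0\<close> exists iff both kernels are
  nontrivial, i.e. iff the rank is less than \<open>min m n\<close>.\<close>

definition singular_values :: "real^'n^'m \<Rightarrow> real set" where
  "singular_values Q = {\<sigma>. \<sigma> \<ge> 0 \<and> (\<exists>(u::real^'m) (v::real^'n). norm u = 1 \<and> norm v = 1 \<and>
     Q *v v = \<sigma> *\<^sub>R u \<and> transpose Q *v u = \<sigma> *\<^sub>R v)}"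

text \<open>The condition number of a rank-deficient matrix is infinite.\<close>

definition cond_num :: "real^'n::finite^'m::finite \<Rightarrow> ereal" where
  "cond_num Q = (if Min (singular_values Q) = 0 then \<infinity>
     else ereal (Max (singular_values Q) / Min (singular_values Q)))"

section \<open>The defining identity of the coefficient matrices\<close>

lemma keys_scaleR_subset: "Poly_Mapping.keys (c *\<^sub>R f) \<subseteq> Poly_Mapping.keys f"
  for f :: rpoly
proof -
  have "finite {i. c *\<^sub>R Poly_Mapping.lookup f i \<noteq> 0}"
    by (rule finite_subset[OF _ finite_lookup[of f]]) auto
  then have "Poly_Mapping.lookup (c *\<^sub>R f) i = c *\<^sub>R Poly_Mapping.lookup f i" for i
    by (simp add: scaleR_poly_mapping_def)
  then show ?thesis by (auto simp: in_keys_iff)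
qed

lemma mon_deg_superset:
  assumes "finite A" "Poly_Mapping.keys m \<subseteq> A"
  shows "mon_deg m = (\<Sum>i\<in>A. Poly_Mapping.lookup m i)"
  unfolding mon_deg_def using assms by (intro sum.mono_neutral_left) (auto simp: in_keys_iff)

lemma mon_deg_add: "mon_deg (a + b) = mon_deg a + mon_deg b"
proof -
  let ?A = "Poly_Mapping.keys a \<union> Poly_Mapping.keys b"
  have "mon_deg (a + b) = (\<Sum>i\<in>?A. Poly_Mapping.lookup (a + b) i)"
    using Poly_Mapping.keys_add[of a b] by (intro mon_deg_superset) auto
  also have "\<dots> = mon_deg a + mon_deg b"
    by (simp add: lookup_add sum.distrib mon_deg_superset[of ?A a] mon_deg_superset[of ?A b])
  finally show ?thesis .
qed

lemma subspace_polys: "subspace (polys n r)"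
proof -
  have "f + g \<in> polys n r" if "f \<in> polys n r" "g \<in> polys n r" for f g
    using that Poly_Mapping.keys_add[of f g] unfolding polys_def by blast
  moreover have "c *\<^sub>R f \<in> polys n r" if "f \<in> polys n r" for c f
    using that keys_scaleR_subset[of c f] unfolding polys_def by blast
  moreover have "0 \<in> polys n r" by (simp add: polys_def)
  ultimately show ?thesis by (auto simp: subspace_def)
qed

lemma polys_mult:
  assumes "f \<in> polys n r" "g \<in> polys n s"
  shows "f * g \<in> polys n (r + s)"
  unfolding polys_def
proof (rule CollectI, rule ballI)
  fix m assume "m \<in> Poly_Mapping.keys (f * g)"
  then obtain a b where m: "m = a + b" "a \<in> Poly_Mapping.keys f" "b \<in> Poly_Mapping.keys g"
    using keys_mult[of f g] by blast
  then show "Poly_Mapping.keys m \<subseteq> {..<n} \<and> mon_deg m \<le> r + s"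
    using assms Poly_Mapping.keys_add[of a b] unfolding polys_def
    by (fastforce simp: mon_deg_add intro: add_mono)
qed

lemma coeff_mat_expansion:
  assumes p: "basis_of p (polys n d)" and q: "basis_of q (polys n (2 * d))"
  shows "p i * p j = (\<Sum>u\<in>UNIV. coeff_mat p q u $ i $ j *\<^sub>R q u)"
proof -
  have "p k \<in> polys n d" for k
    using p span_base[of "p k" "range p"] by (auto simp: basis_of_def)
  then have "p i * p j \<in> span (range q)"
    using polys_mult[of "p i" n d "p j" d] q by (simp add: basis_of_def mult_2)
  then have "p i * p j = (\<Sum>b\<in>range q. representation (range q) (p i * p j) b *\<^sub>R b)"
    using q by (intro real_vector.sum_representation_eq[symmetric]) (auto simp: basis_of_def)
  also have "\<dots> = (\<Sum>u\<in>UNIV. coeff_mat p q u $ i $ j *\<^sub>R q u)"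
    using q by (subst sum.reindex) (auto simp: basis_of_def coeff_mat_def)
  finally show ?thesis .
qed

end

theory Submission
  imports Defs
begin

text \<open>Writing \<open>A = \<Lambda>(x)\<close> and \<open>P = A\<^sup>-\<^sup>1\<close>, the Hessian satisfies
  \<open>v\<^sup>T H(x) v = \<langle>B, P B P\<rangle>\<close> for \<open>B = \<Lambda>(v)\<close>, with the Frobenius inner product. This form lies between
  \<open>\<parallel>B\<parallel>\<^sup>2 / \<sigma>\<^bsub>max\<^esub>(A)\<^sup>2\<close> and \<open>\<parallel>B\<parallel>\<^sup>2 / \<sigma>\<^bsub>min\<^esub>(A)\<^sup>2\<close>, while \<open>\<parallel>B\<parallel>\<close> is the length of the product of the
  \<open>\<Lambda>\<close>-matrix with \<open>v\<close> and so lies between its extreme singular values times \<open>\<parallel>v\<parallel>\<close>. The least singular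
  value of that matrix is positive because every monomial of degree at most \<open>2d\<close> is a product of two
  monomials of degree at most \<open>d\<close>; \<open>A\<close> is positive definite since \<open>x\<close> is interior.\<close>

section \<open>Extremal eigenvectors and singular values\<close>

text \<open>Moving from \<open>v\<close> to \<open>v - t *\<^sub>R f v\<close> gives the form the
  value \<open>- 2 * t * a + t\<^sup>2 * b\<close> with \<open>a = f v \<bullet> f v\<close>. For
  small \<open>t > 0\<close> the linear term would make this negative unless
  \<open>a = 0\<close>.\<close>

lemma psd_form_zero:
  fixes f :: "'a::real_inner \<Rightarrow> 'a"
  assumes lin: "linear f" and sym: "\<And>x y. f x \<bullet> y = x \<bullet> f y"
    and psd: "\<And>w. 0 \<le> w \<bullet> f w" and "v \<bullet> f v = 0"
  shows "f v = 0"
proof (rule ccontr)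
  assume "f v \<noteq> 0"
  define a where "a = f v \<bullet> f v"
  define b where "b = f v \<bullet> f (f v)"
  have a: "a > 0" using \<open>f v \<noteq> 0\<close> by (simp add: a_def)
  have b: "b \<ge> 0" using psd by (simp add: b_def)
  have "0 \<le> - 2 * t * a + t\<^sup>2 * b" for t
  proof -
    have "0 \<le> (v - t *\<^sub>R f v) \<bullet> f (v - t *\<^sub>R f v)" by (rule psd)
    also have "\<dots> = - 2 * t * a + t\<^sup>2 * b"
      using \<open>v \<bullet> f v = 0\<close> sym[of v "f v"]
      by (simp add: linear_diff[OF lin] linear_scale[OF lin] inner_diff_left inner_diff_right
          a_def b_def power2_eq_square algebra_simps)
    finally show ?thesis .
  qed
  \<comment> \<open>The added 1 keeps the denominator positive when \<open>b = 0\<close> and makes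
    the quadratic term at most half of the linear one.\<close>
  from this[of "a / (b + 1)"] have "2 * (a / (b + 1)) * a \<le> (a / (b + 1))\<^sup>2 * b" by simp
  also have "\<dots> = (a / (b + 1)) * a * (b / (b + 1))" by (simp add: power2_eq_square)
  also have "\<dots> \<le> (a / (b + 1)) * a * 1"
    using a b by (intro mult_left_mono) auto
  finally have "(a / (b + 1)) * a \<le> 0" by simp
  moreover have "(a / (b + 1)) * a > 0" using a b by simp
  ultimately show False by linarith
qed

text \<open>The form attains its minimum on the compact unit sphere at some \<open>v\<close>.
  Subtracting that minimum times the identity leaves a positive semidefinite map whose form vanishes
  at \<open>v\<close>, so \<open>psd_form_zero\<close> makes \<open>v\<close> an
  eigenvector.\<close>

lemma selfadjoint_min_eigenvector:
  fixes f :: "'a::euclidean_space \<Rightarrow> 'a"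
  assumes lin: "linear f" and sym: "\<And>x y. f x \<bullet> y = x \<bullet> f y"
  obtains v where "norm v = 1" "f v = (v \<bullet> f v) *\<^sub>R v"
    "\<And>w. (v \<bullet> f v) * (norm w)\<^sup>2 \<le> w \<bullet> f w"
proof -
  have "continuous_on (sphere 0 1) (\<lambda>v. v \<bullet> f v)"
    using lin by (intro continuous_intros linear_continuous_on) (simp add: linear_conv_bounded_linear)
  then obtain v where v: "norm v = 1" "\<And>w. norm w = 1 \<Longrightarrow> v \<bullet> f v \<le> w \<bullet> f w"
    using continuous_attains_inf[OF compact_sphere, of 0 1 "\<lambda>v. v \<bullet> f v"]
      vector_choose_size[of 1, where 'a='a] by (auto simp: sphere_def)
  define m where "m = v \<bullet> f v"
  have ineq: "m * (norm w)\<^sup>2 \<le> w \<bullet> f w" for w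
  proof (cases "w = 0")
    case False
    have "m \<le> (inverse (norm w) *\<^sub>R w) \<bullet> f (inverse (norm w) *\<^sub>R w)"
      unfolding m_def using False by (intro v) simp
    also have "\<dots> = (w \<bullet> f w) / (norm w)\<^sup>2"
      by (simp add: linear_scale[OF lin] power2_eq_square field_simps)
    finally show ?thesis using False by (simp add: field_simps)
  qed (simp add: linear_0[OF lin])
  define g where "g = (\<lambda>w. f w - m *\<^sub>R w)"
  have "g v = 0"
  proof (rule psd_form_zero[of g])
    show "linear g"
      unfolding g_def using lin by (intro linear_compose_sub linear_compose_scale_right)
        (auto simp: linear_id[unfolded id_def])
    show "g x \<bullet> y = x \<bullet> g y" for x y
      by (simp add: g_def sym inner_diff_left inner_diff_right)
    show "0 \<le> w \<bullet> g w" for w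
      using ineq[of w] by (simp add: g_def inner_diff_right power2_norm_eq_inner)
    show "v \<bullet> g v = 0"
      using v(1) by (simp add: g_def m_def inner_diff_right norm_eq_sqrt_inner)
  qed
  then show ?thesis using that[of v] v ineq by (auto simp: g_def m_def)
qed

lemma selfadjoint_max_eigenvector:
  fixes f :: "'a::euclidean_space \<Rightarrow> 'a"
  assumes lin: "linear f" and sym: "\<And>x y. f x \<bullet> y = x \<bullet> f y"
  obtains v where "norm v = 1" "f v = (v \<bullet> f v) *\<^sub>R v"
    "\<And>w. w \<bullet> f w \<le> (v \<bullet> f v) * (norm w)\<^sup>2"
proof -
  obtain v where "norm v = 1" "- f v = (v \<bullet> - f v) *\<^sub>R v"
    "\<And>w. (v \<bullet> - f v) * (norm w)\<^sup>2 \<le> w \<bullet> - f w"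
    using selfadjoint_min_eigenvector[of "\<lambda>x. - f x"] linear_compose_neg[OF lin] sym by auto
  then show ?thesis using that[of v] by simp
qed

section \<open>Singular values via the Gram matrix\<close>

text \<open>Eliminating the left vector \<open>u\<close> turns the square of a singular value into
  an eigenvalue of the selfadjoint Gram map.\<close>

lemma singular_values_norm:
  assumes "\<sigma> \<in> singular_values Q"
  obtains v where "norm v = 1" "norm (Q *v v) = \<sigma>" "transpose Q *v (Q *v v) = \<sigma>\<^sup>2 *\<^sub>R v"
proof -
  obtain u v where "\<sigma> \<ge> 0" "norm u = 1" "norm v = 1" "Q *v v = \<sigma> *\<^sub>R u" "transpose Q *v u = \<sigma> *\<^sub>R v"
    using assms by (auto simp: singular_values_def simp del: transpose_matrix_vector)
  then show ?thesis
    by (intro that[of v]) (simp_all add: matrix_vector_mult_scaleR power2_eq_square del: transpose_matrix_vector)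
qed

lemma inner_transpose: "(transpose Q *v x) \<bullet> y = x \<bullet> (Q *v y)" for Q :: "real^'n^'m"
  by (simp add: dot_lmul_matrix)

text \<open>Eigenvectors of the Gram matrix for distinct eigenvalues are orthogonal, hence
  independent, so the dimension bounds their number. Finiteness lets \<open>Min\<close> and
  \<open>Max\<close> act as true extrema.\<close>

lemma finite_singular_values: "finite (singular_values Q)"
proof -
  have "\<exists>v. norm v = 1 \<and> transpose Q *v (Q *v v) = \<sigma>\<^sup>2 *\<^sub>R v" if "\<sigma> \<in> singular_values Q" for \<sigma>
    using singular_values_norm[OF that] by metis
  then obtain V where V: "\<And>\<sigma>. \<sigma> \<in> singular_values Q \<Longrightarrow> norm (V \<sigma>) = 1"
    "\<And>\<sigma>. \<sigma> \<in> singular_values Q \<Longrightarrow> transpose Q *v (Q *v V \<sigma>) = \<sigma>\<^sup>2 *\<^sub>R V \<sigma>"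
    by metis
  have ortho: "V \<sigma> \<bullet> V \<tau> = 0"
    if "\<sigma> \<in> singular_values Q" "\<tau> \<in> singular_values Q" "\<sigma> \<noteq> \<tau>" for \<sigma> \<tau>
  proof -
    have "\<sigma>\<^sup>2 * (V \<sigma> \<bullet> V \<tau>) = (transpose Q *v (Q *v V \<sigma>)) \<bullet> V \<tau>"
      using that by (simp only: V) simp
    also have "\<dots> = (transpose Q *v (Q *v V \<tau>)) \<bullet> V \<sigma>"
      unfolding inner_transpose by (rule inner_commute)
    also have "\<dots> = \<tau>\<^sup>2 * (V \<sigma> \<bullet> V \<tau>)"
      using that by (simp only: V) (simp add: inner_commute)
    finally have "(\<sigma>\<^sup>2 - \<tau>\<^sup>2) * (V \<sigma> \<bullet> V \<tau>) = 0" by (simp add: algebra_simps)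
    \<comment> \<open>Singular values are nonnegative, so squaring keeps them distinct.\<close>
    moreover have "\<sigma>\<^sup>2 \<noteq> \<tau>\<^sup>2"
      using that by (simp add: singular_values_def)
    ultimately show ?thesis by simp
  qed
  have "inj_on V (singular_values Q)"
  proof (rule inj_onI, rule ccontr)
    fix \<sigma> \<tau> assume *: "\<sigma> \<in> singular_values Q" "\<tau> \<in> singular_values Q" "V \<sigma> = V \<tau>" "\<sigma> \<noteq> \<tau>"
    then have "V \<sigma> \<bullet> V \<sigma> = 0" using ortho[of \<sigma> \<tau>] by simp
    then show False using V(1)[OF *(1)] by simp
  qed
  moreover have "independent (V ` singular_values Q)"
  proof (rule pairwise_orthogonal_independent)
    show "pairwise orthogonal (V ` singular_values Q)"
      using ortho by (force simp: pairwise_def orthogonal_def)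
    show "0 \<notin> V ` singular_values Q" using V(1) by force
  qed
  then have "finite (V ` singular_values Q)" using independent_bound by blast
  ultimately show ?thesis using finite_imageD by blast
qed

lemma gram_selfadjoint:
  fixes Q :: "real^'n^'m"
  shows "linear (\<lambda>v. transpose Q *v (Q *v v))"
    and "(transpose Q *v (Q *v v)) \<bullet> w = v \<bullet> (transpose Q *v (Q *v w))"
proof -
  show "linear (\<lambda>v. transpose Q *v (Q *v v))"
    unfolding matrix_vector_mul_assoc by simp
  show "(transpose Q *v (Q *v v)) \<bullet> w = v \<bullet> (transpose Q *v (Q *v w))"
    unfolding inner_transpose inner_commute[of v]  by (rule inner_commute)
qed

text \<open>The missing left vector is \<open>Q *v v\<close> normalized; pairing the eigenvalue
  equation with \<open>v\<close> forces \<open>\<mu> = (norm (Q *v v))\<^sup>2\<close>.\<close>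

lemma eigenvector_gram_singular_value:
  assumes v: "norm v = 1" "transpose Q *v (Q *v v) = \<mu> *\<^sub>R v" and "Q *v v \<noteq> 0"
  shows "norm (Q *v v) \<in> singular_values Q"
proof -
  have "\<mu> = v \<bullet> (transpose Q *v (Q *v v))" using v(1) by (simp only: v(2)) (simp add: dot_square_norm)
  also have "\<dots> = (norm (Q *v v))\<^sup>2"
    by (subst inner_commute) (simp only: inner_transpose power2_norm_eq_inner)
  finally have "transpose Q *v (inverse (norm (Q *v v)) *\<^sub>R (Q *v v)) = norm (Q *v v) *\<^sub>R v"
    using assms by (simp add: matrix_vector_mult_scaleR power2_eq_square del: transpose_matrix_vector)
  then show ?thesis unfolding singular_values_def
    using assms by (intro CollectI conjI exI[of _ v] exI[of _ "inverse (norm (Q *v v)) *\<^sub>R (Q *v v)"]) auto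
qed

text \<open>The extremal eigenvectors \<open>a\<close> and \<open>b\<close> of the Gram map bound
  \<open>norm (Q *v v)\<close> from both sides. Injectivity makes \<open>Q *v a\<close> and
  \<open>Q *v b\<close> nonzero, so their norms are singular values, lying between
  \<open>Min\<close> and \<open>Max\<close>; it also excludes 0 as a singular value.\<close>

lemma singular_values_injective:
  fixes Q :: "real^'n^'m"
  assumes inj: "\<And>v. Q *v v = 0 \<Longrightarrow> v = 0"
  shows "singular_values Q \<noteq> {}" "Min (singular_values Q) > 0"
    "Min (singular_values Q) * norm v \<le> norm (Q *v v)"
    "norm (Q *v v) \<le> Max (singular_values Q) * norm v"
proof -
  let ?f = "\<lambda>v. transpose Q *v (Q *v v)"
  have form: "w \<bullet> ?f w = (norm (Q *v w))\<^sup>2" for w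
    by (subst inner_commute) (simp only: inner_transpose power2_norm_eq_inner)
  obtain a where a: "norm a = 1" "?f a = (a \<bullet> ?f a) *\<^sub>R a"
    "\<And>w. (a \<bullet> ?f a) * (norm w)\<^sup>2 \<le> w \<bullet> ?f w"
    using selfadjoint_min_eigenvector[OF gram_selfadjoint, of Q] by auto
  obtain b where b: "norm b = 1" "?f b = (b \<bullet> ?f b) *\<^sub>R b"
    "\<And>w. w \<bullet> ?f w \<le> (b \<bullet> ?f b) * (norm w)\<^sup>2"
    using selfadjoint_max_eigenvector[OF gram_selfadjoint, of Q] by auto
  have a': "norm (Q *v a) \<in> singular_values Q"
    using inj[of a] a by (intro eigenvector_gram_singular_value[OF a(1,2)]) auto
  have b': "norm (Q *v b) \<in> singular_values Q"
    using inj[of b] b by (intro eigenvector_gram_singular_value[OF b(1,2)]) auto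
  show ne: "singular_values Q \<noteq> {}" using a' by blast
  have "Min (singular_values Q) \<in> singular_values Q"
    using ne finite_singular_values by (intro Min_in)
  then obtain w where "norm w = 1" "norm (Q *v w) = Min (singular_values Q)"
    using singular_values_norm by metis
  then show "Min (singular_values Q) > 0"
    using inj[of w] by (metis norm_zero zero_less_norm_iff zero_neq_one)
  have "(norm (Q *v a) * norm v)\<^sup>2 \<le> (norm (Q *v v))\<^sup>2"
    using a(3)[of v] by (simp only: form power_mult_distrib)
  then have "norm (Q *v a) * norm v \<le> norm (Q *v v)" by (rule power2_le_imp_le) simp
  moreover have "Min (singular_values Q) \<le> norm (Q *v a)"
    using a' finite_singular_values by (intro Min_le)
  ultimately show "Min (singular_values Q) * norm v \<le> norm (Q *v v)"
    by (meson mult_right_mono norm_ge_zero order_trans)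
  have "(norm (Q *v v))\<^sup>2 \<le> (norm (Q *v b) * norm v)\<^sup>2"
    using b(3)[of v] by (simp only: form power_mult_distrib)
  then have "norm (Q *v v) \<le> norm (Q *v b) * norm v" by (rule power2_le_imp_le) simp
  moreover have "norm (Q *v b) \<le> Max (singular_values Q)"
    using b' finite_singular_values by (intro Max_ge)
  ultimately show "norm (Q *v v) \<le> Max (singular_values Q) * norm v"
    by (meson mult_right_mono norm_ge_zero order_trans)
qed

text \<open>For a singular pair \<open>u\<close>, \<open>v\<close> of a symmetric matrix,
  \<open>u + v\<close> is an eigenvector for \<sigma>, so \<sigma> is a Rayleigh quotient. The case
  \<open>u = - v\<close> would give the form the value \<open>- \<sigma>\<close> at
  \<open>v\<close>, against positive definiteness.\<close>

lemma singular_value_symmetric_bounds: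
  assumes sym: "transpose H = H" and \<sigma>: "\<sigma> \<in> singular_values H" and "\<alpha> > 0"
    and lower: "\<And>v. \<alpha> * (norm v)\<^sup>2 \<le> v \<bullet> (H *v v)"
    and upper: "\<And>v. v \<bullet> (H *v v) \<le> \<beta> * (norm v)\<^sup>2"
  shows "\<alpha> \<le> \<sigma>" "\<sigma> \<le> \<beta>"
proof -
  obtain u v where uv: "norm u = 1" "norm v = 1" "H *v v = \<sigma> *\<^sub>R u" "H *v u = \<sigma> *\<^sub>R v" "\<sigma> \<ge> 0"
    using \<sigma> unfolding singular_values_def sym by auto
  define w where "w = u + v"
  have Hw: "H *v w = \<sigma> *\<^sub>R w" by (simp add: w_def uv matrix_vector_right_distrib scaleR_add_right)
  have "w \<noteq> 0"
  proof
    assume "w = 0"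
    then have "u = - v" by (simp add: w_def eq_neg_iff_add_eq_0)
    then have "v \<bullet> (H *v v) = - \<sigma>" using uv by (simp add: norm_eq_1)
    with lower[of v] uv \<open>\<alpha> > 0\<close> show False by simp
  qed
  moreover have "\<alpha> * (norm w)\<^sup>2 \<le> \<sigma> * (norm w)\<^sup>2" "\<sigma> * (norm w)\<^sup>2 \<le> \<beta> * (norm w)\<^sup>2"
    using lower[of w] upper[of w] by (simp_all add: Hw power2_norm_eq_inner)
  ultimately show "\<alpha> \<le> \<sigma>" "\<sigma> \<le> \<beta>" by simp_all
qed

lemma cond_num_symmetric_le:
  assumes sym: "transpose H = H" and "\<alpha> > 0"
    and lower: "\<And>v. \<alpha> * (norm v)\<^sup>2 \<le> v \<bullet> (H *v v)"
    and upper: "\<And>v. v \<bullet> (H *v v) \<le> \<beta> * (norm v)\<^sup>2"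
  shows "cond_num H \<le> ereal (\<beta> / \<alpha>)"
proof -
  have "v = 0" if "H *v v = 0" for v
    using lower[of v] that \<open>\<alpha> > 0\<close> by (simp add: mult_le_0_iff)
  note sv = singular_values_injective(1,2)[of H, OF this]
  have "Min (singular_values H) \<in> singular_values H" "Max (singular_values H) \<in> singular_values H"
    using sv(1) finite_singular_values by (auto intro!: Min_in Max_in)
  then have "\<alpha> \<le> Min (singular_values H)" "Max (singular_values H) \<le> \<beta>" "\<alpha> \<le> Max (singular_values H)"
    using singular_value_symmetric_bounds[OF sym _ \<open>\<alpha> > 0\<close> lower upper] by blast+
  then have "Max (singular_values H) / Min (singular_values H) \<le> \<beta> / \<alpha>"
    using \<open>\<alpha> > 0\<close> by (intro frac_le) auto
  then show ?thesis using sv(2) by (simp add: cond_num_def)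
qed

section \<open>The Frobenius inner product\<close>

lemma inner_matrix: "(X \<bullet> Y) = (\<Sum>i\<in>UNIV. \<Sum>j\<in>UNIV. X $ i $ j * Y $ i $ j)" for X Y :: "real^'n^'m"
  by (simp add: inner_vec_def)

lemma inner_transpose_transpose: "transpose X \<bullet> transpose Y = X \<bullet> Y" for X Y :: "real^'n^'m"
  unfolding inner_matrix by (subst sum.swap) (simp add: transpose_def)

lemma norm_transpose: "norm (transpose X) = norm X" for X :: "real^'n^'m"
  by (simp add: norm_eq_sqrt_inner inner_transpose_transpose)

text \<open>The Frobenius product sums over rows, and right multiplication by \<open>A\<close> acts
  on each row as \<open>transpose A\<close>.\<close>

lemma inner_mult_right: "(X ** A) \<bullet> Y = X \<bullet> (Y ** transpose A)" for X Y :: "real^'n^'m"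
proof -
  have row: "(Z ** B) $ i = transpose B *v (Z $ i)" for Z :: "real^'n^'m" and B i
    by (simp add: vec_eq_iff matrix_matrix_mult_def vector_matrix_mult_def mult.commute)
  show ?thesis
    unfolding inner_vec_def[where 'b='m] row inner_transpose by simp
qed

lemma inner_mult_left: "(A ** X) \<bullet> Y = X \<bullet> (transpose A ** Y)" for X Y :: "real^'n^'m"
proof -
  have "(A ** X) \<bullet> Y = (transpose X ** transpose A) \<bullet> transpose Y"
    by (simp only: inner_transpose_transpose flip: matrix_transpose_mul)
  also have "\<dots> = transpose X \<bullet> transpose (transpose A ** Y)"
    by (simp only: inner_mult_right matrix_transpose_mul)
  finally show ?thesis by (simp only: inner_transpose_transpose)
qed

text \<open>The squared Frobenius norm is the sum of the squared column norms, and \<open>A\<close>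
  acts on each column separately. Columns appear as rows of the transpose.\<close>

lemma norm_mult_left_le:
  fixes A :: "real^'m^'m" and X :: "real^'n^'m"
  assumes "\<And>w. norm (A *v w) \<le> c * norm w"
  shows "norm (A ** X) \<le> c * norm X"
proof -
  \<comment> \<open>Testing the bound on one unit vector suffices; \<open>undefined\<close> merely
    names some index.\<close>
  have c: "c \<ge> 0" using norm_ge_zero[of "A *v axis undefined 1"] assms[of "axis undefined 1"]
    by (simp del: norm_ge_zero)
  have row: "transpose (A ** X) $ i = A *v (transpose X $ i)" for i
    by (simp add: vec_eq_iff matrix_matrix_mult_def matrix_vector_mult_def transpose_def)
  have "(norm (A ** X))\<^sup>2 = (\<Sum>i\<in>UNIV. (norm (A *v (transpose X $ i)))\<^sup>2)"
    unfolding norm_transpose[of "A ** X", symmetric]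
    by (simp only: power2_norm_eq_inner inner_vec_def[where 'b='n] row)
  also have "\<dots> \<le> (\<Sum>i\<in>UNIV. (c * norm (transpose X $ i))\<^sup>2)"
    by (intro sum_mono power_mono assms) simp
  also have "\<dots> = c\<^sup>2 * (norm (transpose X))\<^sup>2"
    by (simp add: power2_norm_eq_inner power_mult_distrib inner_vec_def[where 'b='n] sum_distrib_left)
  also have "\<dots> = (c * norm X)\<^sup>2" by (simp add: norm_transpose power_mult_distrib)
  finally show ?thesis by (rule power2_le_imp_le) (simp add: c)
qed

lemma norm_mult_right_le:
  fixes A :: "real^'n^'n" and X :: "real^'n^'m"
  assumes "\<And>w. norm (transpose A *v w) \<le> c * norm w"
  shows "norm (X ** A) \<le> c * norm X"
  using norm_mult_left_le[OF assms, where X = "transpose X"]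
  by (simp add: norm_transpose flip: matrix_transpose_mul)

text \<open>The form splits into the forms of \<open>A\<close> at the columns of \<open>X\<close>,
  at least one of which is nonzero.\<close>

lemma inner_mult_left_pos:
  fixes A :: "real^'m^'m" and X :: "real^'n^'m"
  assumes "\<And>w. w \<noteq> 0 \<Longrightarrow> w \<bullet> (A *v w) > 0" and "X \<noteq> 0"
  shows "X \<bullet> (A ** X) > 0"
proof -
  have row: "transpose (A ** X) $ i = A *v (transpose X $ i)" for i
    by (simp add: vec_eq_iff matrix_matrix_mult_def matrix_vector_mult_def transpose_def)
  have eq: "X \<bullet> (A ** X) = (\<Sum>i\<in>UNIV. (transpose X $ i) \<bullet> (A *v (transpose X $ i)))"
    unfolding inner_transpose_transpose[of X "A ** X", symmetric]
    by (simp only: inner_vec_def[where 'b='n] row)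
  have nn: "w \<bullet> (A *v w) \<ge> 0" for w using assms(1)[of w] by (cases "w = 0") auto
  have "transpose X \<noteq> 0" using \<open>X \<noteq> 0\<close> norm_transpose[of X] by auto
  then obtain i where "transpose X $ i \<noteq> 0" by (auto simp: vec_eq_iff)
  then show ?thesis unfolding eq
    using assms(1) nn by (intro sum_pos2[of _ i]) auto
qed

lemma inner_mult_right_pos:
  fixes A :: "real^'n^'n" and X :: "real^'n^'m"
  assumes "\<And>w. w \<noteq> 0 \<Longrightarrow> w \<bullet> (A *v w) > 0" and "transpose A = A" and "X \<noteq> 0"
  shows "X \<bullet> (X ** A) > 0"
proof -
  have "transpose X \<noteq> 0" using \<open>X \<noteq> 0\<close> by (metis norm_eq_zero norm_transpose)
  from inner_mult_left_pos[OF assms(1) this] show ?thesis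
    by (metis assms(2) inner_transpose_transpose matrix_transpose_mul transpose_transpose)
qed

lemma linear_matrix_congruence: "linear (\<lambda>X. A ** X ** B)"
  for A :: "real^'n^'m" and B :: "real^'k^'l"
  by (rule linearI) (simp_all add: matrix_matrix_mult_def vec_eq_iff sum.distrib algebra_simps
      sum_distrib_left sum_distrib_right)

lemma inner_matrix_congruence:
  fixes P :: "real^'m^'m" and Q :: "real^'n^'n"
  shows "(P ** X ** Q) \<bullet> Y = X \<bullet> (transpose P ** Y ** transpose Q)"
  by (subst inner_mult_right, subst inner_mult_left) (simp add: matrix_mul_assoc)

section \<open>Inverses and positive definite matrices\<close>

lemma matrix_inv_mult:
  fixes A :: "real^'n^'n"
  assumes "det A \<noteq> 0"
  shows "A ** matrix_inv A = mat 1" "matrix_inv A ** A = mat 1"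
proof -
  have "\<exists>A'. A ** A' = mat 1 \<and> A' ** A = mat 1"
    using assms by (simp add: invertible_det_nz flip: invertible_def)
  from someI_ex[OF this] show "A ** matrix_inv A = mat 1" "matrix_inv A ** A = mat 1"
    by (simp_all add: matrix_inv_def)
qed

lemma transpose_matrix_inv_symmetric:
  fixes A :: "real^'n^'n"
  assumes "det A \<noteq> 0" and sym: "transpose A = A"
  shows "transpose (matrix_inv A) = matrix_inv A"
proof -
  have "transpose (matrix_inv A) ** A = mat 1"
    using arg_cong[OF matrix_inv_mult(1)[OF assms(1)], of transpose]
    by (simp add: matrix_transpose_mul sym transpose_mat)
  then have "transpose (matrix_inv A) ** A ** matrix_inv A = matrix_inv A" by simp
  then show ?thesis
    by (simp add: matrix_inv_mult(1)[OF assms(1)] flip: matrix_mul_assoc)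
qed

lemma tendsto_det:
  fixes A :: "real^'n^'n"
  assumes "(f \<longlongrightarrow> A) F"
  shows "((\<lambda>t. det (f t)) \<longlongrightarrow> det A) F"
  unfolding det_def by (intro tendsto_intros assms)

lemma pos_definite_det_pos:
  fixes A :: "real^'n^'n"
  assumes pos: "\<And>w. w \<noteq> 0 \<Longrightarrow> w \<bullet> (A *v w) > 0"
  shows "det A > 0"
proof -
  \<comment> \<open>The segment from \<open>mat 1\<close> to \<open>A\<close> consists of positive definite, hence nonsingular matrices.\<close>
  define f where "f t = det (mat 1 + t *\<^sub>R (A - mat 1))" for t :: real
  have nz: "f t \<noteq> 0" if t: "0 \<le> t" "t \<le> 1" for t
  proof
    assume "f t = 0"
    then obtain w where w: "w \<noteq> 0" "(mat 1 + t *\<^sub>R (A - mat 1)) *v w = 0"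
      unfolding f_def using invertible_det_nz matrix_left_invertible_ker invertible_left_inverse
      by metis
    have "w \<bullet> ((mat 1 + t *\<^sub>R (A - mat 1)) *v w) = (1 - t) * (w \<bullet> w) + t * (w \<bullet> (A *v w))"
      by (simp add: matrix_vector_mult_add_rdistrib matrix_vector_mult_diff_rdistrib
          inner_add_right inner_diff_right algebra_simps flip: scaleR_matrix_vector_assoc)
    moreover have "\<dots> > 0"
      using t pos[OF w(1)] w(1) by (cases "t = 0") (auto intro!: add_nonneg_pos)
    ultimately show False using w(2) by simp
  qed
  have cont: "continuous_on {0..1} f"
    unfolding f_def continuous_on_def by (intro ballI tendsto_det tendsto_intros)
  show ?thesis
  proof (rule ccontr)
    assume "\<not> ?thesis"
    then have "f 1 \<le> 0" by (simp add: f_def)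
    moreover have "0 \<le> f 0" by (simp add: f_def)
    ultimately obtain t where "0 \<le> t" "t \<le> 1" "f t = 0"
      using IVT2'[of f 1 0 0] cont by auto
    then show False using nz by blast
  qed
qed

text \<open>The lower bound is read off an eigenmatrix \<open>X\<close> of the map \<open>X \<mapsto> P X P\<close> for its least
  eigenvalue \<open>\<tau>\<close>: then \<open>X = \<tau> A X A\<close>, and \<open>P X = \<tau> X A\<close> forces \<open>\<tau> > 0\<close>. This avoids
  square roots of \<open>A\<close>.\<close>

lemma congruence_form_bounds:
  fixes A :: "real^'n^'n"
  assumes sym: "transpose A = A" and pos: "\<And>w. w \<noteq> 0 \<Longrightarrow> w \<bullet> (A *v w) > 0"
    and m: "0 < m" "\<And>w. m * norm w \<le> norm (A *v w)" and M: "\<And>w. norm (A *v w) \<le> M * norm w"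
  defines "P \<equiv> matrix_inv A"
  shows "(norm B)\<^sup>2 / M\<^sup>2 \<le> B \<bullet> (P ** B ** P)" "B \<bullet> (P ** B ** P) \<le> (norm B)\<^sup>2 / m\<^sup>2"
proof -
  have det: "det A \<noteq> 0" using pos_definite_det_pos[OF pos] by simp
  have AP: "A ** P = mat 1" and PA: "P ** A = mat 1"
    using matrix_inv_mult[OF det] by (simp_all add: P_def)
  have symP: "transpose P = P"
    unfolding P_def using det sym by (rule transpose_matrix_inv_symmetric)
  have APw: "A *v (P *v w) = w" for w by (simp add: matrix_vector_mul_assoc AP)
  have P_le: "norm (P *v w) \<le> (1 / m) * norm w" for w
    using m(2)[of "P *v w"] m(1) by (simp add: APw field_simps)
  have posP: "w \<bullet> (P *v w) > 0" if "w \<noteq> 0" for w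
  proof -
    have "P *v w \<noteq> 0" using APw[of w] that by auto
    from pos[OF this] show ?thesis by (simp add: APw inner_commute)
  qed
  \<comment> \<open>Upper bound: one factor \<open>P\<close> moves to the other side, and
    Cauchy-Schwarz leaves two norms, each at most \<open>norm B / m\<close> because \<open>P\<close>
    stretches vectors by at most \<open>1 / m\<close>.\<close>
  have "B \<bullet> (P ** B ** P) = (P ** B) \<bullet> (B ** P)"
    by (simp add: inner_mult_left[of P] symP matrix_mul_assoc)
  also have "\<dots> \<le> norm (P ** B) * norm (B ** P)" by (rule norm_cauchy_schwarz)
  also have "\<dots> \<le> ((1 / m) * norm B) * ((1 / m) * norm B)"
    using P_le symP m(1)
    by (intro mult_mono norm_mult_left_le norm_mult_right_le) auto
  finally show "B \<bullet> (P ** B ** P) \<le> (norm B)\<^sup>2 / m\<^sup>2" by (simp add: power2_eq_square)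
  let ?T = "\<lambda>X. P ** X ** P"
  have "?T X \<bullet> Y = X \<bullet> ?T Y" for X Y
    by (simp add: inner_matrix_congruence symP)
  from selfadjoint_min_eigenvector[OF linear_matrix_congruence this]
  obtain X where X: "norm X = 1" "?T X = (X \<bullet> ?T X) *\<^sub>R X" "\<And>W. (X \<bullet> ?T X) * (norm W)\<^sup>2 \<le> W \<bullet> ?T W"
    by metis
  define \<tau> where "\<tau> = X \<bullet> ?T X"
  have "X \<noteq> 0" using X(1) by auto
  have TX: "?T X = \<tau> *\<^sub>R X" using X(2) by (simp only: \<tau>_def)
  have "P ** X = ?T X ** A" by (simp add: PA flip: matrix_mul_assoc)
  then have PX: "P ** X = \<tau> *\<^sub>R (X ** A)" by (simp add: TX scalar_matrix_assoc)
  then have "X \<bullet> (P ** X) = \<tau> * (X \<bullet> (X ** A))" by simp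
  moreover have "X \<bullet> (P ** X) > 0" "X \<bullet> (X ** A) > 0"
    using inner_mult_left_pos[OF posP \<open>X \<noteq> 0\<close>] inner_mult_right_pos[OF pos sym \<open>X \<noteq> 0\<close>] by auto
  ultimately have \<tau>: "\<tau> > 0" by (simp add: zero_less_mult_iff)
  have "X = A ** (P ** X)" by (simp add: matrix_mul_assoc AP)
  also have "\<dots> = \<tau> *\<^sub>R (A ** X ** A)"
    by (simp add: PX matrix_mul_assoc matrix_scalar_ac scalar_matrix_assoc)
  \<comment> \<open>Taking norms with \<open>norm X = 1\<close> leads to
    \<open>1 \<le> \<tau> * M\<^sup>2\<close>, which bounds the least eigenvalue from below.\<close>
  finally have "1 = \<tau> * norm (A ** X ** A)" using X(1) \<tau> by (metis abs_of_pos norm_scaleR)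
  also have "norm (A ** X ** A) \<le> M * norm (A ** X)"
    using M sym by (intro norm_mult_right_le) simp
  also have "\<dots> \<le> M * (M * norm X)"
  proof (rule mult_left_mono)
    show "norm (A ** X) \<le> M * norm X" using M by (rule norm_mult_left_le)
    have "0 \<le> M * norm (axis undefined 1 :: real^'n)"
      using M[of "axis undefined 1"] norm_ge_zero order_trans by blast
    then show "0 \<le> M" by simp
  qed
  finally have "1 \<le> \<tau> * M\<^sup>2" using X(1) \<tau> by (simp add: power2_eq_square)
  moreover from this have "M\<^sup>2 > 0" by (cases "M = 0") auto
  ultimately have "1 / M\<^sup>2 \<le> \<tau>" by (simp add: pos_divide_le_eq)
  then have "(1 / M\<^sup>2) * (norm B)\<^sup>2 \<le> \<tau> * (norm B)\<^sup>2" by (intro mult_right_mono) auto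
  also have "\<dots> \<le> B \<bullet> ?T B" using X(3) by (simp add: \<tau>_def)
  finally show "(norm B)\<^sup>2 / M\<^sup>2 \<le> B \<bullet> (P ** B ** P)" by simp
qed

section \<open>The Hessian of $-\ln\det$\<close>

text \<open>By Cramer's rule each entry of the inverse is a quotient \<open>c\<close> of
  determinants, continuous where the denominator is nonzero. The formula holds along
  \<open>f\<close> eventually, since \<open>det (f t)\<close> tends to \<open>det A\<close>.\<close>

lemma tendsto_matrix_inv:
  fixes A :: "real^'n^'n"
  assumes f: "(f \<longlongrightarrow> A) F" and "det A \<noteq> 0"
  shows "((\<lambda>t. matrix_inv (f t)) \<longlongrightarrow> matrix_inv A) F"
proof -
  define c where "c = (\<lambda>(B::real^'n^'n) k l. det (\<chi> i j. if j = k then axis l 1 $ i else B $ i $ j) / det B)"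
  have inv: "matrix_inv B = (\<chi> k l. c B k l)" if "det B \<noteq> 0" for B :: "real^'n^'n"
  proof -
    have "B *v (matrix_inv B *v axis l 1) = axis l 1" for l
      by (simp add: matrix_vector_mul_assoc matrix_inv_mult[OF that])
    then have "matrix_inv B *v axis l 1 = (\<chi> k. c B k l)" for l
      unfolding cramer[OF that] c_def .
    then have "matrix_inv B $ k $ l = c B k l" for k l
      by (simp add: matrix_vector_mult_basis column_def vec_eq_iff)
    then show ?thesis by (simp add: vec_eq_iff)
  qed
  have entry: "((\<lambda>t. if j = k then axis l 1 $ i else f t $ i $ j) \<longlongrightarrow>
      (if j = k then axis l 1 $ i else A $ i $ j)) F" for i j k l
    using f by (auto intro!: tendsto_intros)
  have "((\<lambda>t. \<chi> k l. c (f t) k l) \<longlongrightarrow> (\<chi> k l. c A k l)) F"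
    unfolding c_def using \<open>det A \<noteq> 0\<close> f by (intro tendsto_intros tendsto_det entry) auto
  moreover have "\<forall>\<^sub>F t in F. det (f t) \<noteq> 0"
    using tendsto_imp_eventually_ne[OF tendsto_det[OF f] \<open>det A \<noteq> 0\<close>] .
  then have "\<forall>\<^sub>F t in F. (\<chi> k l. c (f t) k l) = matrix_inv (f t)"
    by eventually_elim (simp add: inv)
  ultimately show ?thesis
    using inv[OF \<open>det A \<noteq> 0\<close>] tendsto_cong by force
qed

text \<open>The Leibniz expansion is differentiated termwise. Any permutation other than the
  identity moves at least two indices, so removing one factor still leaves an off-diagonal entry of
  the identity matrix, which is 0.\<close>

lemma DERIV_det_mat_1:
  fixes M :: "real^'n^'n"
  shows "((\<lambda>t. det (mat 1 + t *\<^sub>R M)) has_real_derivative trace M) (at 0)"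
proof -
  have deriv: "((\<lambda>t. \<Prod>i\<in>UNIV. (mat 1 + t *\<^sub>R M) $ i $ s i) has_real_derivative
      (\<Sum>i\<in>UNIV. M $ i $ s i * (\<Prod>j\<in>UNIV - {i}. (mat 1 + 0 *\<^sub>R M) $ j $ s j))) (at 0)" for s
    by (rule has_field_derivative_prod) (auto intro!: derivative_eq_intros)
  have sum: "(\<Sum>i\<in>UNIV. M $ i $ s i * (\<Prod>j\<in>UNIV - {i}. (mat 1 + 0 *\<^sub>R M) $ j $ s j))
      = (if s = id then trace M else 0)" if s: "s permutes (UNIV :: 'n set)" for s
  proof (cases "s = id")
    case True
    then show ?thesis by (simp add: trace_def mat_def)
  next
    case False
    then obtain k where k: "s k \<noteq> k" by (auto simp: fun_eq_iff)
    have "(\<Prod>j\<in>UNIV - {i}. (mat 1 + 0 *\<^sub>R M) $ j $ s j) = 0" for i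
    proof (cases "i = k")
      case True
      \<comment> \<open>When the factor at \<open>k\<close> is the one removed, \<open>s k\<close>
        serves as the second moved index.\<close>
      have "s (s k) \<noteq> s k" using k permutes_inj[OF s] by (simp add: inj_eq)
      then show ?thesis
        using k True by (intro prod_zero bexI[of _ "s k"]) (auto simp: mat_def)
    next
      case False
      then show ?thesis
        using k by (intro prod_zero bexI[of _ k]) (auto simp: mat_def)
    qed
    then show ?thesis using False by (simp only: mult_zero_right sum.neutral_const if_False)
  qed
  have "((\<lambda>t. of_int (sign s) * (\<Prod>i\<in>UNIV. (mat 1 + t *\<^sub>R M) $ i $ s i)) has_real_derivative
      of_int (sign s) * (if s = id then trace M else 0)) (at 0)" if "s permutes (UNIV :: 'n set)" for s
    using DERIV_cmult[OF deriv[of s], of "of_int (sign s)"] unfolding sum[OF that] .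
  then have "((\<lambda>t. det (mat 1 + t *\<^sub>R M)) has_real_derivative
      (\<Sum>s | s permutes (UNIV :: 'n set). of_int (sign s) * (if s = id then trace M else 0))) (at 0)"
    unfolding det_def by (intro DERIV_sum) auto
  also have "(\<Sum>s | s permutes (UNIV :: 'n set). of_int (sign s) * (if s = id then trace M else 0)) = trace M"
    by (subst sum.remove[of _ id]) (auto simp: permutes_id sign_id intro!: sum.neutral)
  finally show ?thesis .
qed

text \<open>Factoring out \<open>A\<close> reduces the claim to the derivative of the determinant at
  the identity; the constant \<open>det A\<close> cancels in the logarithmic derivative.\<close>

lemma DERIV_ln_det:
  fixes A B :: "real^'n^'n"
  assumes "det A > 0"
  shows "((\<lambda>t. ln (det (A + t *\<^sub>R B))) has_real_derivative trace (matrix_inv A ** B)) (at 0)"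
proof -
  let ?M = "matrix_inv A ** B"
  have "A + t *\<^sub>R B = A ** (mat 1 + t *\<^sub>R ?M)" for t
    using assms
    by (simp add: matrix_add_ldistrib matrix_scalar_ac matrix_mul_assoc matrix_inv_mult flip: scalar_matrix_assoc)
  then have "det (A + t *\<^sub>R B) = det A * det (mat 1 + t *\<^sub>R ?M)" for t
    by (simp add: det_mul)
  moreover have "((\<lambda>t. ln (det A * det (mat 1 + t *\<^sub>R ?M))) has_real_derivative trace ?M) (at 0)"
    using assms by (auto intro!: derivative_eq_intros DERIV_det_mat_1)
  ultimately show ?thesis by simp
qed

text \<open>By the resolvent identity the difference quotient equals
  \<open>- ((?P t ** B ** ?P 0) \<bullet> C)\<close> for small nonzero \<open>t\<close>, and
  continuity of the inverse gives its limit. Pairing with a fixed \<open>C\<close> keeps the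
  derivative scalar.\<close>

lemma DERIV_matrix_inv:
  fixes A B :: "real^'n^'n"
  assumes A: "det A \<noteq> 0"
  shows "((\<lambda>t. matrix_inv (A + t *\<^sub>R B) \<bullet> C) has_real_derivative
    - ((matrix_inv A ** B ** matrix_inv A) \<bullet> C)) (at 0)"
  unfolding DERIV_def
proof (rule Lim_transform_eventually)
  let ?P = "\<lambda>t. matrix_inv (A + t *\<^sub>R B)"
  have lim: "((\<lambda>t. A + t *\<^sub>R B) \<longlongrightarrow> A) (at 0)" by (auto intro!: tendsto_eq_intros)
  have "linear (\<lambda>X. - ((X ** B ** ?P 0) \<bullet> C))"
    using linear_matrix_congruence[of "mat 1 :: real^'n^'n" "B ** ?P 0"]
    by (auto simp: linear_iff inner_add_left matrix_mul_assoc)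
  then have "continuous (at (?P 0)) (\<lambda>X. - ((X ** B ** ?P 0) \<bullet> C))"
    by (intro linear_continuous_at) (simp add: linear_conv_bounded_linear)
  from isCont_tendsto_compose[OF this]
  show "((\<lambda>t. - ((?P t ** B ** ?P 0) \<bullet> C)) \<longlongrightarrow> - ((matrix_inv A ** B ** matrix_inv A) \<bullet> C)) (at 0)"
    using tendsto_matrix_inv[OF lim A] by force
  have "\<forall>\<^sub>F t in at 0. det (A + t *\<^sub>R B) \<noteq> 0"
    using tendsto_imp_eventually_ne[OF tendsto_det[OF lim] A] .
  moreover have "\<forall>\<^sub>F t::real in at 0. t \<noteq> 0" by (simp add: eventually_at_filter)
  ultimately show "\<forall>\<^sub>F t in at 0. - ((?P t ** B ** ?P 0) \<bullet> C) = (?P (0 + t) \<bullet> C - ?P 0 \<bullet> C) / t"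
  proof eventually_elim
    case (elim t)
    \<comment> \<open>Evaluating this product in two ways, by cancellation and by expansion, yields
      the resolvent identity.\<close>
    have "?P t ** (A + t *\<^sub>R B) ** ?P 0 = ?P 0"
      using elim by (simp add: matrix_inv_mult)
    moreover have "?P t ** (A + t *\<^sub>R B) ** ?P 0 = ?P t + t *\<^sub>R (?P t ** B ** ?P 0)"
      using A by (simp add: linear_add[OF linear_matrix_congruence] linear_scale[OF linear_matrix_congruence]
          matrix_inv_mult flip: matrix_mul_assoc[of _ A])
    ultimately have "?P t - ?P 0 = - t *\<^sub>R (?P t ** B ** ?P 0)"
      by (simp add: algebra_simps)
    then have "(?P t - ?P 0) \<bullet> C = - t * ((?P t ** B ** ?P 0) \<bullet> C)" by simp
    then show ?case using elim by (simp add: inner_diff_left)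
  qed
qed

lemma trace_mult_inner: "trace (X ** Y) = X \<bullet> transpose Y" for X :: "real^'n^'m" and Y :: "real^'m^'n"
  by (simp add: trace_def matrix_matrix_mult_def inner_matrix transpose_def)

lemma hessian_ln_det:
  fixes L :: "real^'u \<Rightarrow> real^'n^'n"
  assumes lin: "linear L" and sym: "\<And>y. transpose (L y) = L y" and pos: "det (L x) > 0"
  shows "hessian (\<lambda>y. - ln (det (L y))) x $ i $ j =
    (matrix_inv (L x) ** L (axis i 1) ** matrix_inv (L x)) \<bullet> L (axis j 1)"
proof -
  have step: "L (y + t *\<^sub>R axis k 1) = L y + t *\<^sub>R L (axis k 1)" for y t k
    by (simp add: linear_add[OF lin] linear_scale[OF lin])
  have first: "partial_deriv (\<lambda>y. - ln (det (L y))) j y = - (matrix_inv (L y) \<bullet> L (axis j 1))"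
    if "det (L y) > 0" for y
    unfolding partial_deriv_def step
    using DERIV_minus[OF DERIV_ln_det[OF that, of "L (axis j 1)"]]
    by (intro DERIV_imp_deriv) (simp add: trace_mult_inner sym)
  \<comment> \<open>Differentiating again requires the first-order formula on a whole neighbourhood
    of 0; the determinant stays positive there by continuity.\<close>
  have "((\<lambda>t. L x + t *\<^sub>R L (axis i 1)) \<longlongrightarrow> L x) (nhds 0)"
    by (auto intro!: tendsto_eq_intros filterlim_ident)
  from order_tendstoD(1)[OF tendsto_det[OF this] pos]
  have "\<forall>\<^sub>F t in nhds 0. partial_deriv (\<lambda>y. - ln (det (L y))) j (x + t *\<^sub>R axis i 1) =
      - (matrix_inv (L x + t *\<^sub>R L (axis i 1)) \<bullet> L (axis j 1))"
    by eventually_elim (simp add: first step)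
  then have "hessian (\<lambda>y. - ln (det (L y))) x $ i $ j =
      deriv (\<lambda>t. - (matrix_inv (L x + t *\<^sub>R L (axis i 1)) \<bullet> L (axis j 1))) 0"
    by (simp add: hessian_def partial_deriv_def[of _ i] deriv_cong_ev)
  also have "\<dots> = (matrix_inv (L x) ** L (axis i 1) ** matrix_inv (L x)) \<bullet> L (axis j 1)"
    using pos by (intro DERIV_imp_deriv) (auto intro!: derivative_eq_intros DERIV_matrix_inv)
  finally show ?thesis .
qed

text \<open>The entry formula extends bilinearly from the axis vectors to \<open>v\<close>. Symmetry
  holds because congruence by the symmetric \<open>P\<close> is selfadjoint for the Frobenius
  product.\<close>

lemma hessian_ln_det_form:
  fixes L :: "real^'u \<Rightarrow> real^'n^'n"
  assumes lin: "linear L" and sym: "\<And>y. transpose (L y) = L y" and pos: "det (L x) > 0"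
  defines "H \<equiv> hessian (\<lambda>y. - ln (det (L y))) x" and "P \<equiv> matrix_inv (L x)"
  shows "transpose H = H" "v \<bullet> (H *v v) = L v \<bullet> (P ** L v ** P)"
proof -
  have symP: "transpose P = P"
    unfolding P_def using pos sym by (intro transpose_matrix_inv_symmetric) auto
  have adj: "(P ** X ** P) \<bullet> Y = X \<bullet> (P ** Y ** P)" for X Y
    by (simp add: inner_matrix_congruence symP)
  have H: "H $ i $ j = (P ** L (axis i 1) ** P) \<bullet> L (axis j 1)" for i j
    unfolding H_def P_def by (rule hessian_ln_det[OF lin sym pos])
  show "transpose H = H"
    by (simp add: vec_eq_iff transpose_def H) (metis adj inner_commute)
  have L: "L v = (\<Sum>i\<in>UNIV. v $ i *\<^sub>R L (axis i 1))"
  proof -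
    have "v = (\<Sum>i\<in>UNIV. v $ i *\<^sub>R axis i 1)"
      by (simp add: basis_expansion flip: scalar_mult_eq_scaleR)
    then have "L v = L (\<Sum>i\<in>UNIV. v $ i *\<^sub>R axis i 1)" by simp
    also have "\<dots> = (\<Sum>i\<in>UNIV. v $ i *\<^sub>R L (axis i 1))"
      by (simp add: linear_sum[OF lin] linear_scale[OF lin])
    finally show ?thesis .
  qed
  have "(H *v v) $ i = L (axis i 1) \<bullet> (P ** L v ** P)" for i
  proof -
    have "(H *v v) $ i = (P ** L (axis i 1) ** P) \<bullet> L v"
      unfolding L by (simp add: matrix_vector_mult_def H inner_sum_right mult.commute)
    then show ?thesis by (simp add: adj)
  qed
  then have "v \<bullet> (H *v v) = (\<Sum>i\<in>UNIV. v $ i *\<^sub>R L (axis i 1)) \<bullet> (P ** L v ** P)"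
    by (simp add: inner_vec_def[of v] inner_sum_left)
  then show "v \<bullet> (H *v v) = L v \<bullet> (P ** L v ** P)" by (simp flip: L)
qed

section \<open>Polynomials and the operator $\Lambda$\<close>

text \<open>Scalars become constant polynomials, so real bilinearity of the product follows from the
  ring laws.\<close>

lemma scaleR_conv_mult_single: "c *\<^sub>R f = Poly_Mapping.single 0 c * f" for f :: rpoly
proof -
  have "finite {i. c *\<^sub>R Poly_Mapping.lookup f i \<noteq> 0}"
    by (rule finite_subset[OF _ finite_lookup[of f]]) auto
  then have "c *\<^sub>R f = Poly_Mapping.map ((*) c) f"
    by (intro poly_mapping_eqI) (simp add: scaleR_poly_mapping_def map.rep_eq when_def)
  then show ?thesis by (simp add: mult_map_scale_conv_mult)
qed

lemma linear_mult_left: "linear (\<lambda>f. f * g)" for g :: rpoly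
  by (rule linearI) (simp_all add: scaleR_conv_mult_single algebra_simps)

lemma linear_mult_right: "linear (\<lambda>g. f * g)" for f :: rpoly
  by (rule linearI) (simp_all add: scaleR_conv_mult_single algebra_simps)

text \<open>Single variables are moved from \<open>b\<close> to \<open>a\<close> until
  \<open>a\<close> has degree \<open>k\<close>.\<close>

lemma monomial_split:
  assumes "k \<le> mon_deg m"
  shows "\<exists>a b. m = a + b \<and> mon_deg a = k"
  using assms
proof (induction k)
  case 0
  show ?case by (rule exI[of _ 0], rule exI[of _ m]) (simp add: mon_deg_def)
next
  case (Suc k)
  then obtain a b where ab: "m = a + b" "mon_deg a = k" by auto
  then have "mon_deg b \<noteq> 0" using Suc.prems by (simp add: mon_deg_add)
  then obtain i where i: "i \<in> Poly_Mapping.keys b" unfolding mon_deg_def by force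
  let ?e = "Poly_Mapping.single i (1::nat)"
  have "b = ?e + (b - ?e)"
    using i by (intro poly_mapping_eqI)
      (auto simp: lookup_add lookup_minus lookup_single when_def in_keys_iff)
  then have "m = (a + ?e) + (b - ?e)" using ab by (simp add: add.assoc)
  moreover have "mon_deg ?e = 1" by (simp add: mon_deg_def)
  then have "mon_deg (a + ?e) = Suc k" using ab by (simp add: mon_deg_add)
  ultimately show ?case by blast
qed

lemma single_in_polys:
  assumes "Poly_Mapping.keys m \<subseteq> {..<n}" "mon_deg m \<le> r"
  shows "Poly_Mapping.single m c \<in> polys n r"
  using assms by (simp add: polys_def)

lemma single_product:
  assumes "Poly_Mapping.keys m \<subseteq> {..<n}" "mon_deg m \<le> r + s"
  obtains f g where "f \<in> polys n r" "g \<in> polys n s" "Poly_Mapping.single m c = f * g"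
proof -
  \<comment> \<open>The first factor takes as much degree as \<open>r\<close> allows, leaving at
    most \<open>s\<close> for the second; the minimum covers monomials of degree below
    \<open>r\<close>.\<close>
  obtain a b where ab: "m = a + b" "mon_deg a = min r (mon_deg m)"
    using monomial_split[of "min r (mon_deg m)" m] by auto
  \<comment> \<open>Exponents are natural numbers, so nothing cancels and both factors involve only
    variables of \<open>m\<close>.\<close>
  then have "Poly_Mapping.keys m = Poly_Mapping.keys a \<union> Poly_Mapping.keys b"
    by (auto simp: in_keys_iff lookup_add)
  moreover have "mon_deg a \<le> r" "mon_deg b \<le> s" using ab assms(2) by (auto simp: mon_deg_add)
  ultimately show ?thesis
    using assms(1) ab
    by (intro that[of "Poly_Mapping.single a c" "Poly_Mapping.single b 1"] single_in_polys)
      (auto simp: mult_single)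
qed

lemma poly_eq_sum_single:
  "f = (\<Sum>m\<in>Poly_Mapping.keys f. Poly_Mapping.single m (Poly_Mapping.lookup f m))"
  for f :: "'a \<Rightarrow>\<^sub>0 real"
  by (intro poly_mapping_eqI)
    (simp add: lookup_sum lookup_single when_def in_keys_iff)

text \<open>Every monomial of degree at most \<open>r + s\<close> splits into allowed factors, so
  the products span \<open>polys n (r + s)\<close>.\<close>

lemma linear_polys_eq_0:
  fixes l :: "rpoly \<Rightarrow> 'v::real_vector"
  assumes lin: "linear l" and prod: "\<And>f g. f \<in> polys n r \<Longrightarrow> g \<in> polys n s \<Longrightarrow> l (f * g) = 0"
    and f: "f \<in> polys n (r + s)"
  shows "l f = 0"
proof -
  have "l (Poly_Mapping.single m (Poly_Mapping.lookup f m)) = 0" if "m \<in> Poly_Mapping.keys f" for m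
    using single_product[of m n r s "Poly_Mapping.lookup f m"] that f prod
    unfolding polys_def by (smt (verit) mem_Collect_eq)
  then have "(\<Sum>m\<in>Poly_Mapping.keys f. l (Poly_Mapping.single m (Poly_Mapping.lookup f m))) = 0"
    by simp
  then show ?thesis
    by (subst poly_eq_sum_single) (simp add: linear_sum[OF lin])
qed

section \<open>The operator and its moment functional\<close>

lemma linear_Lam: "linear (Lam p q)"
  by (rule linearI) (simp_all add: Lam_def scaleR_add_left sum.distrib scaleR_sum_right)

lemma transpose_Lam: "transpose (Lam p q y) = Lam p q y"
  by (simp add: vec_eq_iff transpose_def Lam_def coeff_mat_def mult.commute)

lemma Lam_matrix_mult: "Lam_matrix p q *v y = vec_mat (Lam p q y)"
  by (simp add: vec_eq_iff matrix_vector_mult_def Lam_matrix_def vec_mat_def Lam_def mult.commute)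

lemma norm_vec_mat: "norm (vec_mat A) = norm A"
proof -
  have "vec_mat A \<bullet> vec_mat A = (\<Sum>(j, i)\<in>UNIV \<times> UNIV. A $ i $ j * A $ i $ j)"
    by (simp add: inner_vec_def vec_mat_def case_prod_beta)
  also have "\<dots> = A \<bullet> A"
    unfolding inner_matrix by (subst sum.swap) (rule sum.cartesian_product[symmetric])
  finally show ?thesis by (simp add: norm_eq_sqrt_inner)
qed

text \<open>The functional \<open>l\<close> below is the one with \<open>q u \<mapsto> y $ u\<close>, so that \<open>Lam p q y\<close> is its moment
  matrix \<open>(l (p i * p j))\<close>.\<close>

lemma Lam_functional:
  fixes p :: "'l::finite \<Rightarrow> rpoly" and q :: "'u::finite \<Rightarrow> rpoly"
  assumes p: "basis_of p (polys n d)" and q: "basis_of q (polys n (2 * d))"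
  shows "\<exists>l :: rpoly \<Rightarrow> real. linear l \<and> (\<forall>u. l (q u) = y $ u) \<and>
    (\<forall>i j. Lam p q y $ i $ j = l (p i * p j))"
proof -
  have "inj q" "independent (range q)" using q by (auto simp: basis_of_def)
  from linear_independent_extend[OF this(2), of "\<lambda>f. y $ inv q f"]
  obtain l where l: "linear l" "\<And>u. l (q u) = y $ u"
    using \<open>inj q\<close> by auto
  have "Lam p q y $ i $ j = l (p i * p j)" for i j
    unfolding coeff_mat_expansion[OF p q] linear_sum[OF l(1)] linear_scale[OF l(1)] l(2)
    by (simp add: Lam_def mult.commute)
  with l show ?thesis by blast
qed

lemma basis_of_expansion:
  fixes b :: "'i::finite \<Rightarrow> 'v::real_vector"
  assumes b: "basis_of b W" and f: "f \<in> W"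
  obtains c :: "real^'i" where "f = (\<Sum>i\<in>UNIV. c $ i *\<^sub>R b i)"
proof -
  from b f have "f \<in> span (range b)" by (simp add: basis_of_def)
  then have "f = (\<Sum>v\<in>range b. representation (range b) f v *\<^sub>R v)"
    using b by (intro real_vector.sum_representation_eq[symmetric]) (auto simp: basis_of_def)
  also have "\<dots> = (\<Sum>i\<in>UNIV. representation (range b) f (b i) *\<^sub>R b i)"
    using b by (subst sum.reindex) (auto simp: basis_of_def)
  finally show ?thesis
    by (intro that[of "\<chi> i. representation (range b) f (b i)"]) simp
qed

lemma basis_of_sum_eq_0:
  fixes b :: "'i::finite \<Rightarrow> 'v::real_vector"
  assumes b: "basis_of b W" and "(\<Sum>i\<in>UNIV. c i *\<^sub>R b i) = 0"
  shows "c i = 0"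
proof -
  have inj: "inj b" and ind: "independent (range b)" using b by (auto simp: basis_of_def)
  have "(\<Sum>v\<in>range b. c (inv b v) *\<^sub>R v) = 0"
    using assms(2) inj by (subst sum.reindex) auto
  from independentD[OF ind _ _ this, of "b i"] show ?thesis using inj by simp
qed

text \<open>A zero moment matrix means that \<open>l\<close> kills all \<open>p i * p j\<close>, by
  bilinearity all products from \<open>polys n d\<close>, and hence all of
  \<open>polys n (2 * d)\<close>, including each \<open>q u\<close>. This gives injectivity of the
  matrix of \<Lambda>.\<close>

lemma Lam_eq_0D:
  fixes p :: "'l::finite \<Rightarrow> rpoly" and q :: "'u::finite \<Rightarrow> rpoly"
  assumes p: "basis_of p (polys n d)" and q: "basis_of q (polys n (2 * d))"
    and "Lam p q y = 0"
  shows "y = 0"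
proof -
  obtain l :: "rpoly \<Rightarrow> real" where l: "linear l" "\<And>u. l (q u) = y $ u"
    "\<And>i j. Lam p q y $ i $ j = l (p i * p j)"
    using Lam_functional[OF p q, of y] by (elim exE conjE) simp
  have "l (f * g) = 0" if f: "f \<in> polys n d" and g: "g \<in> polys n d" for f g
  proof -
    obtain a :: "real^'l" where "f = (\<Sum>i\<in>UNIV. a $ i *\<^sub>R p i)"
      by (rule basis_of_expansion[OF p f])
    moreover obtain c :: "real^'l" where "g = (\<Sum>i\<in>UNIV. c $ i *\<^sub>R p i)"
      by (rule basis_of_expansion[OF p g])
    ultimately show ?thesis
      using \<open>Lam p q y = 0\<close>
      by (simp add: linear_sum[OF linear_mult_left] linear_scale[OF linear_mult_left]
          linear_sum[OF linear_mult_right] linear_scale[OF linear_mult_right]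
          linear_sum[OF l(1)] linear_scale[OF l(1)] flip: l(3))
  qed
  moreover have "q u \<in> polys n (d + d)" for u
    using q span_base[of "q u" "range q"] by (simp add: basis_of_def mult_2)
  ultimately have "y $ u = 0" for u
    using linear_polys_eq_0[OF l(1), of n d d "q u"] l(2) by simp
  then show ?thesis by (simp add: vec_eq_iff)
qed

section \<open>Positive definiteness at interior points of the dual cone\<close>

text \<open>A small step from \<open>x\<close> in direction \<open>- s\<close> stays in the dual
  cone, so \<open>s \<bullet> x\<close> is at least a positive multiple of
  \<open>s \<bullet> s\<close>.\<close>

lemma interior_dual_cone_pos:
  assumes x: "x \<in> interior (dual_cone S)" and s: "s \<in> S" "s \<noteq> 0"
  shows "s \<bullet> x > 0"
proof -
  obtain e where e: "e > 0" "ball x e \<subseteq> dual_cone S" using x by (auto simp: mem_interior)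
  \<comment> \<open>The step \<open>t *\<^sub>R s\<close> has length \<open>e / 2\<close>, within
    the open ball.\<close>
  define t where "t = e / (2 * norm s)"
  have "t > 0" using e s by (simp add: t_def)
  have "x - t *\<^sub>R s \<in> ball x e" using e s by (simp add: t_def dist_norm)
  then have "x - t *\<^sub>R s \<in> dual_cone S" using e by blast
  then have "s \<bullet> (x - t *\<^sub>R s) \<ge> 0" using s by (simp add: dual_cone_def)
  moreover have "t * (s \<bullet> s) > 0" using \<open>t > 0\<close> s by simp
  ultimately show ?thesis by (simp add: inner_diff_right)
qed

text \<open>The form at \<open>w\<close> is \<open>l (f\<^sup>2)\<close> for the polynomial
  \<open>f\<close> with coefficients \<open>w\<close> in the basis \<open>p\<close>. This equals
  \<open>s \<bullet> x\<close> for the coefficient vector \<open>s\<close> of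
  \<open>f\<^sup>2\<close>, a nonzero member of the cone.\<close>

lemma Lam_pos_definite:
  fixes p :: "'l::finite \<Rightarrow> rpoly" and q :: "'u::finite \<Rightarrow> rpoly"
  assumes p: "basis_of p (polys n d)" and q: "basis_of q (polys n (2 * d))"
    and x: "x \<in> interior (dual_cone (sos_cone n d q))" and "w \<noteq> 0"
  shows "w \<bullet> (Lam p q x *v w) > 0"
proof -
  obtain l :: "rpoly \<Rightarrow> real" where l: "linear l" "\<And>u. l (q u) = x $ u"
    "\<And>i j. Lam p q x $ i $ j = l (p i * p j)"
    using Lam_functional[OF p q, of x] by (elim exE conjE) simp
  define f where "f = (\<Sum>i\<in>UNIV. w $ i *\<^sub>R p i)"
  have "p i \<in> polys n d" for i
    using p span_base[of "p i" "range p"] by (auto simp: basis_of_def)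
  then have f: "f \<in> polys n d"
    unfolding f_def by (intro subspace_sum subspace_scale subspace_polys)
  then have "f\<^sup>2 \<in> polys n (2 * d)"
    using polys_mult[of f n d f d] by (simp add: power2_eq_square mult_2)
  then obtain s :: "real^'u" where s: "f\<^sup>2 = (\<Sum>u\<in>UNIV. s $ u *\<^sub>R q u)"
    by (rule basis_of_expansion[OF q])
  have "s \<in> sos_cone n d q"
    unfolding sos_cone_def using f s by (intro CollectI exI[of _ "[f]"]) simp
  \<comment> \<open>Independence of \<open>p\<close> gives \<open>f \<noteq> 0\<close>; then
    \<open>f\<^sup>2 \<noteq> 0\<close>, since the polynomial ring has no zero divisors, and so
    \<open>s \<noteq> 0\<close>.\<close>
  moreover have "f \<noteq> 0"
    using basis_of_sum_eq_0[OF p, of "($) w"] \<open>w \<noteq> 0\<close> by (auto simp: f_def vec_eq_iff)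
  then have "s \<noteq> 0" using s by (auto simp: power2_eq_square)
  ultimately have "s \<bullet> x > 0" using interior_dual_cone_pos[OF x] by blast
  also have "s \<bullet> x = l (f\<^sup>2)"
    unfolding s by (simp add: linear_sum[OF l(1)] linear_scale[OF l(1)] l(2) inner_vec_def)
  also have "\<dots> = w \<bullet> (Lam p q x *v w)"
    unfolding power2_eq_square f_def
    by (simp add: linear_sum[OF linear_mult_left] linear_scale[OF linear_mult_left]
          linear_sum[OF linear_mult_right] linear_scale[OF linear_mult_right]
          linear_sum[OF l(1)] linear_scale[OF l(1)] inner_vec_def matrix_vector_mult_def
          sum_distrib_left mult_ac flip: l(3))
  finally show ?thesis .
qed

section \<open>The condition number of the Hessian\<close>

theorem theorem4p2:
  fixes n d :: nat
    and p :: "'l::finite \<Rightarrow> rpoly"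
    and q :: "'u::finite \<Rightarrow> rpoly"
    and x :: "real^'u"
  assumes "basis_of p (polys n d)"
    and "basis_of q (polys n (2 * d))"
    and "x \<in> interior (dual_cone (sos_cone n d q))"
  shows "cond_num (hessian (\<lambda>y. - ln (det (Lam p q y))) x)
           \<le> (cond_num (Lam_matrix p q))\<^sup>2 * (cond_num (Lam p q x))\<^sup>2"
proof -
  let ?A = "Lam p q x" and ?Q = "Lam_matrix p q"
  define m M where "m = Min (singular_values ?A)" and "M = Max (singular_values ?A)"
  define s S where "s = Min (singular_values ?Q)" and "S = Max (singular_values ?Q)"
  have pos: "w \<bullet> (?A *v w) > 0" if "w \<noteq> 0" for w
    using Lam_pos_definite[OF assms that] .
  have det: "det ?A > 0" using pos by (rule pos_definite_det_pos)
  have "w = 0" if "?A *v w = 0" for w using pos[of w] that by auto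
  note A = singular_values_injective[of ?A, OF this, folded m_def M_def]
  have norm_Q: "norm (?Q *v v) = norm (Lam p q v)" for v
    by (simp add: Lam_matrix_mult norm_vec_mat)
  have "v = 0" if "?Q *v v = 0" for v
    using norm_Q[of v] that Lam_eq_0D[OF assms(1,2)] by simp
  note Q = singular_values_injective[of ?Q, OF this, folded s_def S_def, unfolded norm_Q]
  \<comment> \<open>Together with \<open>m > 0\<close> this makes \<open>M\<close> positive, so that
    \<open>s\<^sup>2 / M\<^sup>2\<close> is a positive lower bound.\<close>
  have "m \<le> M"
    unfolding m_def M_def using A(1) finite_singular_values by (intro Max_ge Min_in)
  let ?H = "hessian (\<lambda>y. - ln (det (Lam p q y))) x"
  note H = hessian_ln_det_form[OF linear_Lam transpose_Lam det]
  note bounds = congruence_form_bounds[OF transpose_Lam pos A(2,3,4)]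
  have "cond_num ?H \<le> ereal ((S\<^sup>2 / m\<^sup>2) / (s\<^sup>2 / M\<^sup>2))"
  proof (rule cond_num_symmetric_le)
    show "transpose ?H = ?H" by (rule H)
    show "s\<^sup>2 / M\<^sup>2 > 0" using A(2) Q(2) \<open>m \<le> M\<close> by simp
    fix v
    have "(s * norm v)\<^sup>2 / M\<^sup>2 \<le> (norm (Lam p q v))\<^sup>2 / M\<^sup>2"
      using Q(2,3) by (intro divide_right_mono power_mono) auto
    also have "\<dots> \<le> v \<bullet> (?H *v v)" unfolding H by (rule bounds)
    finally show "s\<^sup>2 / M\<^sup>2 * (norm v)\<^sup>2 \<le> v \<bullet> (?H *v v)" by (simp add: power_mult_distrib)
    have "v \<bullet> (?H *v v) \<le> (norm (Lam p q v))\<^sup>2 / m\<^sup>2" unfolding H by (rule bounds)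
    also have "\<dots> \<le> (S * norm v)\<^sup>2 / m\<^sup>2"
      using Q(4) by (intro divide_right_mono power_mono) auto
    finally show "v \<bullet> (?H *v v) \<le> S\<^sup>2 / m\<^sup>2 * (norm v)\<^sup>2" by (simp add: power_mult_distrib)
  qed
  also have "(S\<^sup>2 / m\<^sup>2) / (s\<^sup>2 / M\<^sup>2) = (S / s)\<^sup>2 * (M / m)\<^sup>2" by (simp add: power_divide)
  \<comment> \<open>Both least singular values are positive, so both condition numbers are finite
    quotients.\<close>
  also have "ereal \<dots> = (cond_num ?Q)\<^sup>2 * (cond_num ?A)\<^sup>2"
    using A(2) Q(2) by (simp add: cond_num_def flip: m_def M_def s_def S_def)
  finally show ?thesis .
qed

end
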